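(* Let $L_\bullet$ be an eg-Lie algebra. The derivation graded Lie algebra $\mathrm{Der}_+(L_\bullet)=(\mathrm{Der}_m(L_\bullet))_{m\ge 1}$ extends to an eg-Lie algebra $\mathrm{Der}_\bullet(L_\bullet)$ by setting $\mathrm{Der}_0(L_\bullet)=\mathrm{Aut}(L_\bullet)$ and by defining an action $$\mathrm{Der}_0(L_\bullet)\times\mathrm{Der}_m(L_\bullet)\longrightarrow\mathrm{Der}_m(L_\bullet),\quad (f,d)\longmapsto {}^fd,$$ for $m\ge1$ by $$({}^fd)_i(a)=f_{m+i}\,d_i\,f_i^{-1}(a)\qquad(i\ge0,\ a\in L_i).$$
   Context: Eg-Lie algebra (extended graded Lie algebra) $L_\bullet=(L_m)_{m\ge 0}$: a group $L_0$, a graded Lie algebra $L_+=(L_m)_{m\ge 1}$ over $\mathbb Z$ (with $[L_m,L_n]\subset L_{m+n}$), and an action $(g,x)\mapsto {}^gx$ of $L_0$ on $L_+$ by degree-preserving Lie algebra automorphisms. A morphism $f_\bullet:L_\bullet\to L'_\bullet$ is a group homomorphism $f_0:L_0\to L'_0$ and a graded Lie algebra morphism $f_+=(f_m)_{m\ge1}$ with $f_m({}^xy)={}^{f_0(x)}(f_m(y))$ for $x\in L_0$, $y\in L_m$, $m\ge 1$. $\mathrm{Aut}(L_\bullet)$ is the group of automorphisms of $L_\bullet$. For $m\ge 1$, $\mathrm{Der}_m(L_\bullet)$ is the abelian group (pointwise addition) of families of maps $d=(d_i:L_i\to L_{m+i})_{i\ge0}$ such that (1) the $d_i$, $i\ge1$,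 are homomorphisms with $d_{i+j}([a,b])=[d_i(a),b]+[a,d_j(b)]$ for $a\in L_i,b\in L_j$, $i,j\ge 1$; (2) $d_0(ab)=d_0(a)+{}^a(d_0(b))$ for $a,b\in L_0$; (3) $d_i({}^ab)=[d_0(a),{}^ab]+{}^a(d_i(b))$ for $a\in L_0$, $b\in L_i$, $i\ge 1$. The graded Lie algebra structure on $\mathrm{Der}_+(L_\bullet)$ is given, for $d\in\mathrm{Der}_m$, $d'\in\mathrm{Der}_n$, by $[d,d']_0(a)=d_n(d'_0(a))-d'_m(d_0(a))-[d_0(a),d'_0(a)]$ for $a\in L_0$, and $[d,d']_i(a)=d_{n+i}(d'_i(a))-d'_{m+i}(d_i(a))$ for $a\in L_i$, $i\ge 1$. *)

theory Defs
  imports "HOL-Algebra.Ring"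
begin

text \<open>
  A graded Lie algebra over the integers, indexed by the degrees \<open>m \<ge> 1\<close>. The homogeneous
  component of degree \<open>m\<close> is an abelian group, represented (as modules are in
  HOL-Algebra) by the additive part of a ring record whose multiplicative fields are
  ignored. The value of any of the fields in degree 0 is irrelevant. There are no Koszul signs.
\<close>

record 'a graded_lie =
  homog :: "nat \<Rightarrow> 'a ring"
  bracket :: "nat \<Rightarrow> nat \<Rightarrow> 'a \<Rightarrow> 'a \<Rightarrow> 'a"

text \<open>
  The Lie algebra axioms on the direct sum, spelled out on homogeneous elements:
  \<open>[x, x] = 0\<close> for all elements of the direct sum amounts to \<open>bracket_self\<close> together with
  \<open>bracket_antisym\<close>.
\<close>

locale graded_lie_algebra =
  fixes L :: "('a, 'm) graded_lie_scheme"
  assumes homog_group: "m \<ge> 1 \<Longrightarrow> abelian_group (homog L m)"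
    and bracket_closed:
      "\<lbrakk>m \<ge> 1; n \<ge> 1; x \<in> carrier (homog L m); y \<in> carrier (homog L n)\<rbrakk>
        \<Longrightarrow> bracket L m n x y \<in> carrier (homog L (m + n))"
    and bracket_add_left:
      "\<lbrakk>m \<ge> 1; n \<ge> 1; x \<in> carrier (homog L m); x' \<in> carrier (homog L m); y \<in> carrier (homog L n)\<rbrakk>
        \<Longrightarrow> bracket L m n (x \<oplus>\<^bsub>homog L m\<^esub> x') y
          = bracket L m n x y \<oplus>\<^bsub>homog L (m + n)\<^esub> bracket L m n x' y"
    and bracket_add_right:
      "\<lbrakk>m \<ge> 1; n \<ge> 1; x \<in> carrier (homog L m); y \<in> carrier (homog L n); y' \<in> carrier (homog L n)\<rbrakk>
        \<Longrightarrow> bracket L m n x (y \<oplus>\<^bsub>homog L n\<^esub> y')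
          = bracket L m n x y \<oplus>\<^bsub>homog L (m + n)\<^esub> bracket L m n x y'"
    and bracket_self:
      "\<lbrakk>m \<ge> 1; x \<in> carrier (homog L m)\<rbrakk>
        \<Longrightarrow> bracket L m m x x = \<zero>\<^bsub>homog L (m + m)\<^esub>"
    and bracket_antisym:
      "\<lbrakk>m \<ge> 1; n \<ge> 1; x \<in> carrier (homog L m); y \<in> carrier (homog L n)\<rbrakk>
        \<Longrightarrow> bracket L m n x y = \<ominus>\<^bsub>homog L (m + n)\<^esub> bracket L n m y x"
    and jacobi:
      "\<lbrakk>m \<ge> 1; n \<ge> 1; p \<ge> 1;
        x \<in> carrier (homog L m); y \<in> carrier (homog L n); z \<in> carrier (homog L p)\<rbrakk>
        \<Longrightarrow> bracket L m (n + p) x (bracket L n p y z)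
          \<oplus>\<^bsub>homog L (m + n + p)\<^esub> bracket L n (p + m) y (bracket L p m z x)
          \<oplus>\<^bsub>homog L (m + n + p)\<^esub> bracket L p (m + n) z (bracket L m n x y)
          = \<zero>\<^bsub>homog L (m + n + p)\<^esub>"

record ('a, 'g) eg_lie = "'a graded_lie" +
  deg0 :: "'g monoid"
  act :: "'g \<Rightarrow> nat \<Rightarrow> 'a \<Rightarrow> 'a"

text \<open>
  Bijectivity of each \<open>act L g m\<close> on the component of degree \<open>m\<close> follows from \<open>act_one\<close>
  and \<open>act_mult\<close>.
\<close>

locale eg_lie_algebra = graded_lie_algebra L
  for L :: "('a, 'g, 'm) eg_lie_scheme" +
  assumes deg0_group: "group (deg0 L)"
    and act_hom:
      "\<lbrakk>g \<in> carrier (deg0 L); m \<ge> 1\<rbrakk>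
        \<Longrightarrow> act L g m \<in> hom (add_monoid (homog L m)) (add_monoid (homog L m))"
    and act_bracket:
      "\<lbrakk>g \<in> carrier (deg0 L); m \<ge> 1; n \<ge> 1; x \<in> carrier (homog L m); y \<in> carrier (homog L n)\<rbrakk>
        \<Longrightarrow> act L g (m + n) (bracket L m n x y) = bracket L m n (act L g m x) (act L g n y)"
    and act_one:
      "\<lbrakk>m \<ge> 1; x \<in> carrier (homog L m)\<rbrakk> \<Longrightarrow> act L \<one>\<^bsub>deg0 L\<^esub> m x = x"
    and act_mult:
      "\<lbrakk>g \<in> carrier (deg0 L); h \<in> carrier (deg0 L); m \<ge> 1; x \<in> carrier (homog L m)\<rbrakk>
        \<Longrightarrow> act L (g \<otimes>\<^bsub>deg0 L\<^esub> h) m x = act L g m (act L h m x)"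

text \<open>
  A family of maps \<open>(f\<^sub>i)\<close>, \<open>i \<ge> 0\<close>, is a pair of the map in degree 0 and the family of
  the maps in degrees \<open>i \<ge> 1\<close>. All maps are extensional, and so is the family in its
  index, so that equality of pairs is equality of families of maps on the carriers.
\<close>

definition additive_maps :: "('a, 'm) ring_scheme \<Rightarrow> ('b, 'n) ring_scheme \<Rightarrow> ('a \<Rightarrow> 'b) set" where
  "additive_maps A B = hom (add_monoid A) (add_monoid B) \<inter> extensional (carrier A)"

definition eg_hom ::
  "('a, 'g, 'm) eg_lie_scheme \<Rightarrow> ('b, 'h, 'n) eg_lie_scheme
    \<Rightarrow> (('g \<Rightarrow> 'h) \<times> (nat \<Rightarrow> 'a \<Rightarrow> 'b)) set" where
  "eg_hom L L' = {(f0, f).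
     f0 \<in> hom (deg0 L) (deg0 L') \<inter> extensional (carrier (deg0 L)) \<and>
     f \<in> (\<Pi>\<^sub>E m\<in>{1..}. additive_maps (homog L m) (homog L' m)) \<and>
     (\<forall>m\<ge>1. \<forall>n\<ge>1. \<forall>x\<in>carrier (homog L m). \<forall>y\<in>carrier (homog L n).
        f (m + n) (bracket L m n x y) = bracket L' m n (f m x) (f n y)) \<and>
     (\<forall>x\<in>carrier (deg0 L). \<forall>m\<ge>1. \<forall>y\<in>carrier (homog L m).
        f m (act L x m y) = act L' (f0 x) m (f m y))}"

definition eg_Aut ::
  "('a, 'g, 'm) eg_lie_scheme \<Rightarrow> (('g \<Rightarrow> 'g) \<times> (nat \<Rightarrow> 'a \<Rightarrow> 'a)) monoid" where
  "eg_Aut L = \<lparr>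
     carrier = {(f0, f) \<in> eg_hom L L.
       bij_betw f0 (carrier (deg0 L)) (carrier (deg0 L)) \<and>
       (\<forall>m\<ge>1. bij_betw (f m) (carrier (homog L m)) (carrier (homog L m)))},
     monoid.mult = (\<lambda>(f0, f) (g0, g).
       (compose (carrier (deg0 L)) f0 g0,
        \<lambda>m\<in>{1..}. compose (carrier (homog L m)) (f m) (g m))),
     monoid.one = (\<lambda>x\<in>carrier (deg0 L). x, \<lambda>m\<in>{1..}. \<lambda>x\<in>carrier (homog L m). x)\<rparr>"

definition derivations ::
  "('a, 'g, 'm) eg_lie_scheme \<Rightarrow> nat \<Rightarrow> (('g \<Rightarrow> 'a) \<times> (nat \<Rightarrow> 'a \<Rightarrow> 'a)) set" where
  "derivations L m = {(d0, d).
     d0 \<in> carrier (deg0 L) \<rightarrow>\<^sub>E carrier (homog L m) \<and>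
     d \<in> (\<Pi>\<^sub>E i\<in>{1..}. additive_maps (homog L i) (homog L (m + i))) \<and>
     (\<forall>i\<ge>1. \<forall>j\<ge>1. \<forall>a\<in>carrier (homog L i). \<forall>b\<in>carrier (homog L j).
        d (i + j) (bracket L i j a b) =
          bracket L (m + i) j (d i a) b
            \<oplus>\<^bsub>homog L (m + i + j)\<^esub> bracket L i (m + j) a (d j b)) \<and>
     (\<forall>a\<in>carrier (deg0 L). \<forall>b\<in>carrier (deg0 L).
        d0 (a \<otimes>\<^bsub>deg0 L\<^esub> b) = d0 a \<oplus>\<^bsub>homog L m\<^esub> act L a m (d0 b)) \<and>
     (\<forall>a\<in>carrier (deg0 L). \<forall>i\<ge>1. \<forall>b\<in>carrier (homog L i).
        d i (act L a i b) =
          bracket L m i (d0 a) (act L a i b)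
            \<oplus>\<^bsub>homog L (m + i)\<^esub> act L a (m + i) (d i b))}"

definition Der_homog ::
  "('a, 'g, 'm) eg_lie_scheme \<Rightarrow> nat \<Rightarrow> (('g \<Rightarrow> 'a) \<times> (nat \<Rightarrow> 'a \<Rightarrow> 'a)) ring" where
  "Der_homog L m = \<lparr>
     carrier = derivations L m,
     monoid.mult = (\<lambda>_ _. undefined),
     monoid.one = undefined,
     zero = (\<lambda>a\<in>carrier (deg0 L). \<zero>\<^bsub>homog L m\<^esub>,
             \<lambda>i\<in>{1..}. \<lambda>a\<in>carrier (homog L i). \<zero>\<^bsub>homog L (m + i)\<^esub>),
     add = (\<lambda>(d0, d) (e0, e).
       (\<lambda>a\<in>carrier (deg0 L). d0 a \<oplus>\<^bsub>homog L m\<^esub> e0 a,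
        \<lambda>i\<in>{1..}. \<lambda>a\<in>carrier (homog L i). d i a \<oplus>\<^bsub>homog L (m + i)\<^esub> e i a))\<rparr>"

definition Der_bracket ::
  "('a, 'g, 'm) eg_lie_scheme \<Rightarrow> nat \<Rightarrow> nat
    \<Rightarrow> ('g \<Rightarrow> 'a) \<times> (nat \<Rightarrow> 'a \<Rightarrow> 'a) \<Rightarrow> ('g \<Rightarrow> 'a) \<times> (nat \<Rightarrow> 'a \<Rightarrow> 'a)
    \<Rightarrow> ('g \<Rightarrow> 'a) \<times> (nat \<Rightarrow> 'a \<Rightarrow> 'a)" where
  "Der_bracket L m n = (\<lambda>(d0, d) (e0, e).
     (\<lambda>a\<in>carrier (deg0 L).
        d n (e0 a) \<ominus>\<^bsub>homog L (m + n)\<^esub> e m (d0 a)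
          \<ominus>\<^bsub>homog L (m + n)\<^esub> bracket L m n (d0 a) (e0 a),
      \<lambda>i\<in>{1..}. \<lambda>a\<in>carrier (homog L i).
        d (n + i) (e i a) \<ominus>\<^bsub>homog L (m + n + i)\<^esub> e (m + i) (d i a)))"

definition Der_plus ::
  "('a, 'g, 'm) eg_lie_scheme \<Rightarrow> (('g \<Rightarrow> 'a) \<times> (nat \<Rightarrow> 'a \<Rightarrow> 'a)) graded_lie" where
  "Der_plus L = \<lparr>homog = Der_homog L, bracket = Der_bracket L\<rparr>"

definition Der_act ::
  "('a, 'g, 'm) eg_lie_scheme \<Rightarrow> ('g \<Rightarrow> 'g) \<times> (nat \<Rightarrow> 'a \<Rightarrow> 'a) \<Rightarrow> nat
    \<Rightarrow> ('g \<Rightarrow> 'a) \<times> (nat \<Rightarrow> 'a \<Rightarrow> 'a) \<Rightarrow> ('g \<Rightarrow> 'a) \<times> (nat \<Rightarrow> 'a \<Rightarrow> 'a)" where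
  "Der_act L = (\<lambda>(f0, f) m (d0, d).
     (\<lambda>a\<in>carrier (deg0 L). f m (d0 (inv_into (carrier (deg0 L)) f0 a)),
      \<lambda>i\<in>{1..}. \<lambda>a\<in>carrier (homog L i).
        f (m + i) (d i (inv_into (carrier (homog L i)) (f i) a))))"

definition Der_eg ::
  "('a, 'g, 'm) eg_lie_scheme
    \<Rightarrow> (('g \<Rightarrow> 'a) \<times> (nat \<Rightarrow> 'a \<Rightarrow> 'a), ('g \<Rightarrow> 'g) \<times> (nat \<Rightarrow> 'a \<Rightarrow> 'a)) eg_lie" where
  "Der_eg L = \<lparr>
     homog = homog (Der_plus L), bracket = bracket (Der_plus L),
     deg0 = eg_Aut L, act = Der_act L\<rparr>"

end

theory Submission imports Defs begin

text \<open>
  In positive degrees the bracket of derivations is the commutator of graded maps and the action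
  of an automorphism is conjugation, so all identities there are formal. The content is in
  degree 0. Write the action of \<open>a \<in> L\<^sub>0\<close> as conjugation in an enveloping algebra. The value
  \<open>d\<^sub>0(a)\<close> is then the logarithmic derivative \<open>d(a) a\<^sup>-\<^sup>1\<close>: the conditions on \<open>d\<^sub>0\<close> are the product
  rule for \<open>d(ab)\<close> and for \<open>d(a b a\<^sup>-\<^sup>1)\<close>. For two derivations,
  \<open>d(e(a)) a\<^sup>-\<^sup>1 = d(e\<^sub>0(a) a) a\<^sup>-\<^sup>1 = d(e\<^sub>0(a)) + e\<^sub>0(a) d\<^sub>0(a)\<close>, and antisymmetrising gives
  \<open>d(e\<^sub>0(a)) - e(d\<^sub>0(a)) - [d\<^sub>0(a), e\<^sub>0(a)]\<close>, which explains the extra term in the degree 0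
  component of the bracket.

  The proof verifies this inside \<open>L\<close>. Closure of derivations under the bracket
  (\<open>Der_bracket_closed\<close>) holds because the extra term cancels the cross terms which the twisted
  product rule produces: by antisymmetry for products \<open>ab\<close> in \<open>L\<^sub>0\<close>, by the Jacobi identity of \<open>L\<close>
  for the action of \<open>L\<^sub>0\<close>. In the Jacobi identity of derivations (\<open>Der_bracket_jacobi\<close>), degree 0
  again reduces, after cancellation in pairs, to the Jacobi identity of \<open>L\<close> for the three elements
  \<open>d\<^sub>0(a)\<close>, \<open>e\<^sub>0(a)\<close>, \<open>h\<^sub>0(a)\<close>. The action of \<open>Aut(L)\<close> is transport of structure: an automorphism and its inverse commute with
  every operation of \<open>L\<close> (locale \<open>eg_automorphism\<close>), hence conjugation preserves derivations, their
  sums and their brackets.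

  Two derivations are equal once they agree on all carriers (\<open>derivations_eqI\<close>), so after closure
  each law is an identity between signed sums in one abelian group, which rewriting decides.
\<close>

section \<open>Identities in abelian groups\<close>

text \<open>
  A decision procedure for identities between signed sums: all negative summands are moved to the
  other side of the equation, after which both sides are sums without signs and
  associativity and commutativity suffice. Cancelling \<open>x\<close> against \<open>\<ominus> x\<close> directly
  would require them to be neighbours, which ordered rewriting does not ensure.
\<close>

context abelian_group
begin

lemma a_minus_move:
  assumes "x \<in> carrier G" "y \<in> carrier G" "z \<in> carrier G"
  shows diff_eq: "(x \<ominus> y = z) = (x = z \<oplus> y)"
    and eq_diff: "(z = x \<ominus> y) = (z \<oplus> y = x)"
    and add_diff: "x \<oplus> (y \<ominus> z) = (x \<oplus> y) \<ominus> z"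
    and diff_add: "(x \<ominus> y) \<oplus> z = (x \<oplus> z) \<ominus> y"
    and diff_diff_right: "x \<ominus> (y \<ominus> z) = (x \<oplus> z) \<ominus> y"
    and diff_diff_left: "(x \<ominus> y) \<ominus> z = x \<ominus> (y \<oplus> z)"
proof -
  have cancel: "(a \<ominus> b) \<oplus> b = a" if "a \<in> carrier G" "b \<in> carrier G" for a b
    using that by (simp add: a_minus_def a_assoc l_neg)
  show "(x \<ominus> y = z) = (x = z \<oplus> y)"
    using assms cancel[of x y] by (metis add.right_cancel minus_closed)
  then show "(z = x \<ominus> y) = (z \<oplus> y = x)" by metis
qed (use assms in \<open>simp_all add: a_minus_def minus_add a_ac\<close>)

lemma a_inv_as_diff: "x \<in> carrier G \<Longrightarrow> \<ominus> x = \<zero> \<ominus> x"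
  by (simp add: a_minus_def)

lemmas a_minus_simps =
  diff_eq eq_diff add_diff diff_add diff_diff_right diff_diff_left a_inv_as_diff

end

lemma additive_hom_simps:
  assumes "abelian_group A" "abelian_group B" and h: "h \<in> hom (add_monoid A) (add_monoid B)"
  shows additive_hom_zero: "h \<zero>\<^bsub>A\<^esub> = \<zero>\<^bsub>B\<^esub>"
    and additive_hom_diff: "\<And>x y. \<lbrakk>x \<in> carrier A; y \<in> carrier A\<rbrakk> \<Longrightarrow> h (x \<ominus>\<^bsub>A\<^esub> y) = h x \<ominus>\<^bsub>B\<^esub> h y"
proof -
  interpret A: abelian_group A by fact
  interpret B: abelian_group B by fact
  interpret h: group_hom "add_monoid A" "add_monoid B" h
    by (rule group_hom.intro[OF A.a_group B.a_group], unfold_locales) (rule h)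
  show "h \<zero>\<^bsub>A\<^esub> = \<zero>\<^bsub>B\<^esub>" using h.hom_one by simp
  fix x y assume xy: "x \<in> carrier A" "y \<in> carrier A"
  have "h (\<ominus>\<^bsub>A\<^esub> y) = \<ominus>\<^bsub>B\<^esub> h y"
    using h.hom_inv[of y] xy by (simp add: a_inv_def)
  then show "h (x \<ominus>\<^bsub>A\<^esub> y) = h x \<ominus>\<^bsub>B\<^esub> h y"
    using h.hom_mult[of x "\<ominus>\<^bsub>A\<^esub> y"] xy by (simp add: a_minus_def)
qed

section \<open>Calculating in an eg-Lie algebra\<close>

context graded_lie_algebra
begin

lemmas homog_closed =
  abelian_group.minus_closed[OF homog_group]
  abelian_group.a_inv_closed[OF homog_group]
  abelian_monoid.a_closed[OF abelian_group.axioms(1)[OF homog_group]]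
  abelian_monoid.zero_closed[OF abelian_group.axioms(1)[OF homog_group]]

lemmas homog_ac =
  abelian_monoid.a_ac[OF abelian_group.axioms(1)[OF homog_group]]
  abelian_monoid.l_zero[OF abelian_group.axioms(1)[OF homog_group]]
  abelian_monoid.r_zero[OF abelian_group.axioms(1)[OF homog_group]]

lemmas homog_diff = abelian_group.a_minus_simps[OF homog_group]

text \<open>
  The degree of the result is a variable tied to \<open>m + n\<close> by an equation. The rule
  then applies to a degree written as any rearrangement of \<open>m + n\<close>, in particular to the sorted sums
  that arise when degrees are normalised by associativity and commutativity. The same device recurs below.
\<close>

lemma bracket_in:
  "\<lbrakk>m \<ge> 1; n \<ge> 1; k = m + n; x \<in> carrier (homog L m); y \<in> carrier (homog L n)\<rbrakk>
    \<Longrightarrow> bracket L m n x y \<in> carrier (homog L k)"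
  using bracket_closed by simp

lemma bracket_left_hom:
  "\<lbrakk>m \<ge> 1; n \<ge> 1; y \<in> carrier (homog L n)\<rbrakk>
    \<Longrightarrow> (\<lambda>x. bracket L m n x y) \<in> hom (add_monoid (homog L m)) (add_monoid (homog L (m + n)))"
  by (simp add: hom_def bracket_closed bracket_add_left)

lemma bracket_right_hom:
  "\<lbrakk>m \<ge> 1; n \<ge> 1; x \<in> carrier (homog L m)\<rbrakk>
    \<Longrightarrow> bracket L m n x \<in> hom (add_monoid (homog L n)) (add_monoid (homog L (m + n)))"
  by (simp add: hom_def bracket_closed bracket_add_right)

lemma bracket_simps:
  assumes "m \<ge> 1" "n \<ge> 1"
  shows "y \<in> carrier (homog L n) \<Longrightarrow> bracket L m n \<zero>\<^bsub>homog L m\<^esub> y = \<zero>\<^bsub>homog L (m + n)\<^esub>"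
    and "x \<in> carrier (homog L m) \<Longrightarrow> bracket L m n x \<zero>\<^bsub>homog L n\<^esub> = \<zero>\<^bsub>homog L (m + n)\<^esub>"
    and "\<lbrakk>x \<in> carrier (homog L m); x' \<in> carrier (homog L m); y \<in> carrier (homog L n)\<rbrakk>
      \<Longrightarrow> bracket L m n (x \<ominus>\<^bsub>homog L m\<^esub> x') y
        = bracket L m n x y \<ominus>\<^bsub>homog L (m + n)\<^esub> bracket L m n x' y"
    and "\<lbrakk>x \<in> carrier (homog L m); y \<in> carrier (homog L n); y' \<in> carrier (homog L n)\<rbrakk>
      \<Longrightarrow> bracket L m n x (y \<ominus>\<^bsub>homog L n\<^esub> y')
        = bracket L m n x y \<ominus>\<^bsub>homog L (m + n)\<^esub> bracket L m n x y'"
  using assms additive_hom_zero[OF homog_group homog_group bracket_left_hom]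
    additive_hom_zero[OF homog_group homog_group bracket_right_hom]
    additive_hom_diff[OF homog_group homog_group bracket_left_hom]
    additive_hom_diff[OF homog_group homog_group bracket_right_hom]
  by simp_all

end

context eg_lie_algebra
begin

lemma act_in:
  "\<lbrakk>g \<in> carrier (deg0 L); m \<ge> 1; x \<in> carrier (homog L m)\<rbrakk> \<Longrightarrow> act L g m x \<in> carrier (homog L m)"
  using hom_in_carrier[OF act_hom, of g m x] by simp

lemma act_bracket':
  "\<lbrakk>g \<in> carrier (deg0 L); m \<ge> 1; n \<ge> 1; k = m + n; x \<in> carrier (homog L m); y \<in> carrier (homog L n)\<rbrakk>
    \<Longrightarrow> act L g k (bracket L m n x y) = bracket L m n (act L g m x) (act L g n y)"
  using act_bracket by simp

lemma act_simps:
  assumes "g \<in> carrier (deg0 L)" "m \<ge> 1"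
  shows "act L g m \<zero>\<^bsub>homog L m\<^esub> = \<zero>\<^bsub>homog L m\<^esub>"
    and "\<lbrakk>x \<in> carrier (homog L m); y \<in> carrier (homog L m)\<rbrakk>
      \<Longrightarrow> act L g m (x \<oplus>\<^bsub>homog L m\<^esub> y) = act L g m x \<oplus>\<^bsub>homog L m\<^esub> act L g m y"
    and "\<lbrakk>x \<in> carrier (homog L m); y \<in> carrier (homog L m)\<rbrakk>
      \<Longrightarrow> act L g m (x \<ominus>\<^bsub>homog L m\<^esub> y) = act L g m x \<ominus>\<^bsub>homog L m\<^esub> act L g m y"
  using assms additive_hom_zero[OF homog_group homog_group act_hom]
    additive_hom_diff[OF homog_group homog_group act_hom]
    hom_mult[OF act_hom, of g m x y]
  by simp_all

text \<open>
  The Jacobi identity, oriented for rewriting at given \<open>x\<close>, \<open>y\<close> and \<open>z\<close>: with these left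
  schematic the rule would loop, since its right-hand side contains nested brackets again.
\<close>

lemma jacobi_solved:
  assumes "m \<ge> 1" "n \<ge> 1" "p \<ge> 1" "k = n + p"
    and "x \<in> carrier (homog L m)" "y \<in> carrier (homog L n)" "z \<in> carrier (homog L p)"
  shows "bracket L m k x (bracket L n p y z) = \<ominus>\<^bsub>homog L (m + n + p)\<^esub>
    (bracket L n (p + m) y (bracket L p m z x) \<oplus>\<^bsub>homog L (m + n + p)\<^esub>
     bracket L p (m + n) z (bracket L m n x y))"
  using jacobi[OF assms(1-3,5-7)] assms
  by (simp add: homog_closed homog_ac homog_diff bracket_in ac_simps)

lemma jacobi_leibniz:
  assumes "m \<ge> 1" "n \<ge> 1" "p \<ge> 1" "k = n + p"
    and "x \<in> carrier (homog L m)" "y \<in> carrier (homog L n)" "z \<in> carrier (homog L p)"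
  shows "bracket L m k x (bracket L n p y z) =
    bracket L (m + n) p (bracket L m n x y) z \<oplus>\<^bsub>homog L (m + n + p)\<^esub>
    bracket L n (m + p) y (bracket L m p x z)"
proof -
  have "bracket L n (p + m) y (bracket L p m z x) =
      \<ominus>\<^bsub>homog L (m + n + p)\<^esub> bracket L n (m + p) y (bracket L m p x z)"
    using assms by (simp add: homog_closed homog_ac homog_diff bracket_in bracket_simps
      bracket_antisym[of p m z x] ac_simps)
  moreover have "bracket L p (m + n) z (bracket L m n x y) =
      \<ominus>\<^bsub>homog L (m + n + p)\<^esub> bracket L (m + n) p (bracket L m n x y) z"
    using assms bracket_antisym[of p "m + n" z "bracket L m n x y"]
    by (simp add: bracket_in ac_simps)
  ultimately have "bracket L m k x (bracket L n p y z) = \<ominus>\<^bsub>homog L (m + n + p)\<^esub>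
      (\<ominus>\<^bsub>homog L (m + n + p)\<^esub> bracket L n (m + p) y (bracket L m p x z)
        \<oplus>\<^bsub>homog L (m + n + p)\<^esub>
       \<ominus>\<^bsub>homog L (m + n + p)\<^esub> bracket L (m + n) p (bracket L m n x y) z)"
    using jacobi_solved[OF assms] by simp
  then show ?thesis
    using assms by (simp add: homog_closed homog_ac homog_diff bracket_in ac_simps)
qed

lemmas deg0_closed = monoid.m_closed[OF group.is_monoid[OF deg0_group]]
  monoid.one_closed[OF group.is_monoid[OF deg0_group]]

lemmas eg_simps = homog_closed homog_ac homog_diff bracket_in bracket_add_left bracket_add_right
  bracket_simps act_in act_bracket' act_simps deg0_closed

end

section \<open>Derivations\<close>

locale eg_derivation = eg_lie_algebra L
  for L :: "('a, 'g, 'm) eg_lie_scheme" +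
  fixes m :: nat and d0 :: "'g \<Rightarrow> 'a" and d :: "nat \<Rightarrow> 'a \<Rightarrow> 'a"
  assumes degree_pos: "m \<ge> 1"
    and derivation: "(d0, d) \<in> derivations L m"
begin

lemma d0_in: "a \<in> carrier (deg0 L) \<Longrightarrow> d0 a \<in> carrier (homog L m)"
  using derivation by (auto simp: derivations_def)

lemma d_hom: "i \<ge> 1 \<Longrightarrow> d i \<in> hom (add_monoid (homog L i)) (add_monoid (homog L (m + i)))"
  using derivation by (auto simp: derivations_def additive_maps_def)

lemma d_in: "\<lbrakk>i \<ge> 1; k = m + i; a \<in> carrier (homog L i)\<rbrakk> \<Longrightarrow> d i a \<in> carrier (homog L k)"
  using hom_in_carrier[OF d_hom, of i a] by simp

lemma d_additive:
  assumes "i \<ge> 1"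
  shows "d i \<zero>\<^bsub>homog L i\<^esub> = \<zero>\<^bsub>homog L (m + i)\<^esub>"
    and "\<lbrakk>x \<in> carrier (homog L i); y \<in> carrier (homog L i)\<rbrakk>
      \<Longrightarrow> d i (x \<oplus>\<^bsub>homog L i\<^esub> y) = d i x \<oplus>\<^bsub>homog L (m + i)\<^esub> d i y"
    and "\<lbrakk>x \<in> carrier (homog L i); y \<in> carrier (homog L i)\<rbrakk>
      \<Longrightarrow> d i (x \<ominus>\<^bsub>homog L i\<^esub> y) = d i x \<ominus>\<^bsub>homog L (m + i)\<^esub> d i y"
  using assms degree_pos additive_hom_zero[OF homog_group homog_group d_hom]
    additive_hom_diff[OF homog_group homog_group d_hom] hom_mult[OF d_hom, of i x y]
  by simp_all

lemma d_bracket: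
  "\<lbrakk>i \<ge> 1; j \<ge> 1; k = i + j; a \<in> carrier (homog L i); b \<in> carrier (homog L j)\<rbrakk>
    \<Longrightarrow> d k (bracket L i j a b) = bracket L (m + i) j (d i a) b
      \<oplus>\<^bsub>homog L (m + i + j)\<^esub> bracket L i (m + j) a (d j b)"
  using derivation by (auto simp: derivations_def)

lemma d0_mult:
  "\<lbrakk>a \<in> carrier (deg0 L); b \<in> carrier (deg0 L)\<rbrakk>
    \<Longrightarrow> d0 (a \<otimes>\<^bsub>deg0 L\<^esub> b) = d0 a \<oplus>\<^bsub>homog L m\<^esub> act L a m (d0 b)"
  using derivation by (auto simp: derivations_def)

lemma d_act:
  "\<lbrakk>a \<in> carrier (deg0 L); i \<ge> 1; b \<in> carrier (homog L i)\<rbrakk>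
    \<Longrightarrow> d i (act L a i b) = bracket L m i (d0 a) (act L a i b)
      \<oplus>\<^bsub>homog L (m + i)\<^esub> act L a (m + i) (d i b)"
  using derivation by (auto simp: derivations_def)

lemma degree_pos_Suc: "Suc 0 \<le> m" "Suc 0 \<le> m + k" "Suc 0 \<le> k + m"
  using degree_pos by simp_all

lemmas d_simps = degree_pos_Suc d0_in d_in d_additive d_bracket d0_mult d_act

end

lemma derivationsE:
  assumes "eg_lie_algebra L" "m \<ge> 1" "x \<in> derivations L m"
  obtains d0 d where "x = (d0, d)" "eg_derivation L m d0 d"
  using assms by (cases x) (auto simp: eg_derivation_def eg_derivation_axioms_def)

text \<open>
  All maps of a family are extensional, so they are determined by their values on the carriers.
\<close>

lemma derivations_eqI:
  assumes "x \<in> derivations L m" "y \<in> derivations L m"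
    and "\<And>a. a \<in> carrier (deg0 L) \<Longrightarrow> fst x a = fst y a"
    and "\<And>i a. \<lbrakk>i \<ge> 1; a \<in> carrier (homog L i)\<rbrakk> \<Longrightarrow> snd x i a = snd y i a"
  shows "x = y"
proof (rule prod_eqI)
  show "fst x = fst y"
    using assms(1-3) by (intro extensionalityI[of _ "carrier (deg0 L)"])
      (auto simp: derivations_def PiE_def)
  show "snd x = snd y"
  proof (rule extensionalityI[of _ "{1..}"])
    fix i :: nat assume "i \<in> {1..}"
    then show "snd x i = snd y i"
      using assms(1,2,4) by (intro extensionalityI[of _ "carrier (homog L i)"])
        (auto simp: derivations_def additive_maps_def PiE_def)
  qed (use assms(1,2) in \<open>auto simp: derivations_def PiE_def\<close>)
qed

context eg_lie_algebra
begin

lemma derivationsI: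
  assumes "d0 \<in> extensional (carrier (deg0 L))" "d \<in> extensional {1..}"
    and "\<And>i. i \<ge> 1 \<Longrightarrow> d i \<in> extensional (carrier (homog L i))"
    and "\<And>a. a \<in> carrier (deg0 L) \<Longrightarrow> d0 a \<in> carrier (homog L m)"
    and "\<And>i a. \<lbrakk>i \<ge> 1; a \<in> carrier (homog L i)\<rbrakk> \<Longrightarrow> d i a \<in> carrier (homog L (m + i))"
    and "\<And>i a b. \<lbrakk>i \<ge> 1; a \<in> carrier (homog L i); b \<in> carrier (homog L i)\<rbrakk>
      \<Longrightarrow> d i (a \<oplus>\<^bsub>homog L i\<^esub> b) = d i a \<oplus>\<^bsub>homog L (m + i)\<^esub> d i b"
    and "\<And>i j a b. \<lbrakk>i \<ge> 1; j \<ge> 1; a \<in> carrier (homog L i); b \<in> carrier (homog L j)\<rbrakk>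
      \<Longrightarrow> d (i + j) (bracket L i j a b) = bracket L (m + i) j (d i a) b
        \<oplus>\<^bsub>homog L (m + i + j)\<^esub> bracket L i (m + j) a (d j b)"
    and "\<And>a b. \<lbrakk>a \<in> carrier (deg0 L); b \<in> carrier (deg0 L)\<rbrakk>
      \<Longrightarrow> d0 (a \<otimes>\<^bsub>deg0 L\<^esub> b) = d0 a \<oplus>\<^bsub>homog L m\<^esub> act L a m (d0 b)"
    and "\<And>a i b. \<lbrakk>a \<in> carrier (deg0 L); i \<ge> 1; b \<in> carrier (homog L i)\<rbrakk>
      \<Longrightarrow> d i (act L a i b) = bracket L m i (d0 a) (act L a i b)
        \<oplus>\<^bsub>homog L (m + i)\<^esub> act L a (m + i) (d i b)"
  shows "(d0, d) \<in> derivations L m"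
  using assms by (auto simp: derivations_def additive_maps_def hom_def PiE_iff)

subsection \<open>The abelian groups of derivations\<close>

lemma Der_zero_closed:
  assumes "m \<ge> 1" shows "\<zero>\<^bsub>Der_homog L m\<^esub> \<in> derivations L m"
  unfolding Der_homog_def ring.simps
  by (rule derivationsI) (use assms in \<open>simp_all add: eg_simps ac_simps\<close>)

lemma Der_neg_closed:
  assumes "eg_derivation L m d0 d"
  shows "(\<lambda>a\<in>carrier (deg0 L). \<ominus>\<^bsub>homog L m\<^esub> d0 a,
    \<lambda>i\<in>{1..}. \<lambda>a\<in>carrier (homog L i). \<ominus>\<^bsub>homog L (m + i)\<^esub> d i a) \<in> derivations L m"
proof -
  interpret D: eg_derivation L m d0 d by fact
  show ?thesis
    by (rule derivationsI) (simp_all add: eg_simps D.d_simps ac_simps)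
qed

lemma Der_add_closed:
  assumes "m \<ge> 1" "x \<in> derivations L m" "y \<in> derivations L m"
  shows "x \<oplus>\<^bsub>Der_homog L m\<^esub> y \<in> derivations L m"
proof -
  obtain d0 d where x: "x = (d0, d)" and "eg_derivation L m d0 d"
    using derivationsE[OF eg_lie_algebra_axioms assms(1,2)] .
  then interpret D: eg_derivation L m d0 d by simp
  obtain e0 e where y: "y = (e0, e)" and "eg_derivation L m e0 e"
    using derivationsE[OF eg_lie_algebra_axioms assms(1,3)] .
  then interpret E: eg_derivation L m e0 e by simp
  show ?thesis
    unfolding x y Der_homog_def ring.simps prod.case
    by (rule derivationsI) (simp_all add: eg_simps D.d_simps E.d_simps ac_simps)
qed


subsection \<open>The Lie bracket of derivations\<close>

text \<open>
  Only the conditions on the degree 0 component use more than the product rules. Writing \<open>a\<cdot>\<close> for the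
  action of \<open>a\<close>, the value of \<open>d(e\<^sub>0(ab)) - e(d\<^sub>0(ab))\<close> contains the cross terms
  \<open>[d\<^sub>0(a), a\<cdot>e\<^sub>0(b)] - [e\<^sub>0(a), a\<cdot>d\<^sub>0(b)]\<close>. The same terms occur in \<open>[d\<^sub>0(ab), e\<^sub>0(ab)]\<close>
  up to antisymmetry. On \<open>a\<cdot>b\<close> with \<open>b\<close> of positive degree, the surplus of
  \<open>de - ed\<close> is \<open>[e\<^sub>0(a), [d\<^sub>0(a), a\<cdot>b]] - [d\<^sub>0(a), [e\<^sub>0(a), a\<cdot>b]]\<close>, which the
  Jacobi identity turns into \<open>- [[d\<^sub>0(a), e\<^sub>0(a)], a\<cdot>b]\<close>.
\<close>

lemma Der_bracket_closed:
  assumes "m \<ge> 1" "n \<ge> 1" "x \<in> derivations L m" "y \<in> derivations L n"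
  shows "Der_bracket L m n x y \<in> derivations L (m + n)"
proof -
  obtain d0 d where x: "x = (d0, d)" and "eg_derivation L m d0 d"
    using derivationsE[OF eg_lie_algebra_axioms assms(1,3)] .
  then interpret D: eg_derivation L m d0 d by simp
  obtain e0 e where y: "y = (e0, e)" and "eg_derivation L n e0 e"
    using derivationsE[OF eg_lie_algebra_axioms assms(2,4)] .
  then interpret E: eg_derivation L n e0 e by simp
  note simps = eg_simps D.d_simps E.d_simps ac_simps
  show ?thesis
    unfolding x y Der_bracket_def prod.case
  proof (rule derivationsI, goal_cases)
    case (8 a b) then show ?case
      by (simp add: simps bracket_antisym[of n m "e0 a" "act L a m (d0 b)"])
  next
    case (9 a i b) then show ?case
      by (simp add: simps jacobi_leibniz[of m n i _ "d0 a" "e0 a" "act L a i b"])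
  qed (use assms(1,2) in \<open>simp_all add: simps\<close>)
qed

lemma Der_homog_abelian_group:
  assumes "m \<ge> 1" shows "abelian_group (Der_homog L m)"
proof -
  have car: "carrier (Der_homog L m) = derivations L m" by (simp add: Der_homog_def)
  note D = derivationsE[OF eg_lie_algebra_axioms assms]
  show ?thesis
  proof (rule abelian_groupI; unfold car)
    fix x y z assume xyz: "x \<in> derivations L m" "y \<in> derivations L m" "z \<in> derivations L m"
    obtain d0 d where x: "x = (d0, d)" and "eg_derivation L m d0 d" using D[OF xyz(1)] .
    then interpret D: eg_derivation L m d0 d by simp
    obtain e0 e where y: "y = (e0, e)" and "eg_derivation L m e0 e" using D[OF xyz(2)] .
    then interpret E: eg_derivation L m e0 e by simp
    obtain h0 h where z: "z = (h0, h)" and "eg_derivation L m h0 h" using D[OF xyz(3)] .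
    then interpret H: eg_derivation L m h0 h by simp
    note simps = x y z Der_homog_def eg_simps D.d_simps E.d_simps H.d_simps ac_simps
    show "x \<oplus>\<^bsub>Der_homog L m\<^esub> y \<oplus>\<^bsub>Der_homog L m\<^esub> z
      = x \<oplus>\<^bsub>Der_homog L m\<^esub> (y \<oplus>\<^bsub>Der_homog L m\<^esub> z)"
      by (rule derivations_eqI[of _ L m]; (intro Der_add_closed assms xyz)?) (simp_all add: simps)
    show "x \<oplus>\<^bsub>Der_homog L m\<^esub> y = y \<oplus>\<^bsub>Der_homog L m\<^esub> x"
      by (rule derivations_eqI[of _ L m]; (intro Der_add_closed assms xyz)?) (simp_all add: simps)
    show "\<zero>\<^bsub>Der_homog L m\<^esub> \<oplus>\<^bsub>Der_homog L m\<^esub> x = x"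
      by (rule derivations_eqI[of _ L m]; (intro Der_add_closed Der_zero_closed assms xyz)?)
        (simp_all add: simps)
    show "\<exists>y\<in>derivations L m. y \<oplus>\<^bsub>Der_homog L m\<^esub> x = \<zero>\<^bsub>Der_homog L m\<^esub>"
    proof (rule bexI[OF _ Der_neg_closed[OF D.eg_derivation_axioms]], rule derivations_eqI[of _ L m];
        (intro Der_add_closed Der_zero_closed Der_neg_closed D.eg_derivation_axioms assms xyz)?)
    qed (simp_all add: simps)
  qed (intro Der_add_closed Der_zero_closed assms; assumption)+
qed

lemma Der_bracket_additive:
  assumes m: "m \<ge> 1" and n: "n \<ge> 1"
    and x: "x \<in> derivations L m" "x' \<in> derivations L m"
    and y: "y \<in> derivations L n"
  shows Der_bracket_add_left: "Der_bracket L m n (x \<oplus>\<^bsub>Der_homog L m\<^esub> x') y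
      = Der_bracket L m n x y \<oplus>\<^bsub>Der_homog L (m + n)\<^esub> Der_bracket L m n x' y"
    and Der_bracket_add_right: "Der_bracket L n m y (x \<oplus>\<^bsub>Der_homog L m\<^esub> x')
      = Der_bracket L n m y x \<oplus>\<^bsub>Der_homog L (n + m)\<^esub> Der_bracket L n m y x'"
proof -
  obtain d0 d where x1: "x = (d0, d)" and "eg_derivation L m d0 d"
    using derivationsE[OF eg_lie_algebra_axioms m x(1)] .
  then interpret D: eg_derivation L m d0 d by simp
  obtain e0 e where x2: "x' = (e0, e)" and "eg_derivation L m e0 e"
    using derivationsE[OF eg_lie_algebra_axioms m x(2)] .
  then interpret E: eg_derivation L m e0 e by simp
  obtain h0 h where y1: "y = (h0, h)" and "eg_derivation L n h0 h"
    using derivationsE[OF eg_lie_algebra_axioms n y] .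
  then interpret H: eg_derivation L n h0 h by simp
  have mn: "m + n \<ge> 1" "n + m \<ge> 1" using m by simp_all
  note simps = x1 x2 y1 Der_homog_def Der_bracket_def eg_simps D.d_simps E.d_simps H.d_simps ac_simps
  show "Der_bracket L m n (x \<oplus>\<^bsub>Der_homog L m\<^esub> x') y
      = Der_bracket L m n x y \<oplus>\<^bsub>Der_homog L (m + n)\<^esub> Der_bracket L m n x' y"
    by (rule derivations_eqI[of _ L "m + n"]; (intro Der_add_closed Der_bracket_closed m n mn x y)?)
      (simp_all add: simps)
  show "Der_bracket L n m y (x \<oplus>\<^bsub>Der_homog L m\<^esub> x')
      = Der_bracket L n m y x \<oplus>\<^bsub>Der_homog L (n + m)\<^esub> Der_bracket L n m y x'"
    by (rule derivations_eqI[of _ L "n + m"]; (intro Der_add_closed Der_bracket_closed m n mn x y)?)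
      (simp_all add: simps)
qed

lemma Der_bracket_self:
  assumes m: "m \<ge> 1" and x: "x \<in> derivations L m"
  shows "Der_bracket L m m x x = \<zero>\<^bsub>Der_homog L (m + m)\<^esub>"
proof -
  obtain d0 d where x1: "x = (d0, d)" and "eg_derivation L m d0 d"
    using derivationsE[OF eg_lie_algebra_axioms m x] .
  then interpret D: eg_derivation L m d0 d by simp
  have mm: "m + m \<ge> 1" using m by simp
  show ?thesis
    by (rule derivations_eqI[of _ L "m + m"]; (intro Der_zero_closed Der_bracket_closed m mm x)?)
      (simp_all add: x1 Der_homog_def Der_bracket_def eg_simps D.d_simps bracket_self ac_simps)
qed

lemma Der_bracket_antisym:
  assumes m: "m \<ge> 1" and n: "n \<ge> 1" and x: "x \<in> derivations L m" and y: "y \<in> derivations L n"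
  shows "Der_bracket L m n x y = \<ominus>\<^bsub>Der_homog L (m + n)\<^esub> Der_bracket L n m y x"
proof -
  obtain d0 d where x1: "x = (d0, d)" and "eg_derivation L m d0 d"
    using derivationsE[OF eg_lie_algebra_axioms m x] .
  then interpret D: eg_derivation L m d0 d by simp
  obtain e0 e where y1: "y = (e0, e)" and "eg_derivation L n e0 e"
    using derivationsE[OF eg_lie_algebra_axioms n y] .
  then interpret E: eg_derivation L n e0 e by simp
  have mn: "m + n \<ge> 1" using m by simp
  have yx: "Der_bracket L n m y x \<in> derivations L (m + n)"
    using Der_bracket_closed[OF n m y x] by (simp add: add.commute)
  have "Der_bracket L m n x y \<oplus>\<^bsub>Der_homog L (m + n)\<^esub> Der_bracket L n m y x
    = \<zero>\<^bsub>Der_homog L (m + n)\<^esub>"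
  proof (rule derivations_eqI[of _ L "m + n"];
      (intro Der_zero_closed Der_add_closed Der_bracket_closed m n mn x y yx)?)
    fix a assume "a \<in> carrier (deg0 L)"
    then show "fst (Der_bracket L m n x y \<oplus>\<^bsub>Der_homog L (m + n)\<^esub> Der_bracket L n m y x) a
        = fst \<zero>\<^bsub>Der_homog L (m + n)\<^esub> a"
      by (simp add: x1 y1 Der_homog_def Der_bracket_def eg_simps D.d_simps E.d_simps ac_simps
        bracket_antisym[of n m "e0 a" "d0 a"])
  qed (simp add: x1 y1 Der_homog_def Der_bracket_def eg_simps D.d_simps E.d_simps ac_simps)
  then show ?thesis
    using abelian_group.minus_equality[OF Der_homog_abelian_group[OF mn]]
      Der_bracket_closed[OF m n x y] yx
    by (simp add: Der_homog_def)
qed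

text \<open>
  In positive degrees this is the Jacobi identity for commutators. In degree 0 the cyclic sum
  expands into three kinds of terms. Those in which two of the maps are applied to a degree 0 value,
  such as \<open>d(e(h\<^sub>0(a)))\<close>, cancel in pairs. So do the brackets such as \<open>[d(e\<^sub>0(a)), h\<^sub>0(a)]\<close>,
  which come with opposite signs from applying the product rule to \<open>d [e\<^sub>0(a), h\<^sub>0(a)]\<close> and from
  the extra term of the outer bracket. What is left is the cyclic sum of
  \<open>[d\<^sub>0(a), [e\<^sub>0(a), h\<^sub>0(a)]]\<close>.
\<close>

lemma Der_bracket_jacobi:
  assumes m: "m \<ge> 1" and n: "n \<ge> 1" and p: "p \<ge> 1"
    and x: "x \<in> derivations L m" and y: "y \<in> derivations L n" and z: "z \<in> derivations L p"
  shows "Der_bracket L m (n + p) x (Der_bracket L n p y z)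
      \<oplus>\<^bsub>Der_homog L (m + n + p)\<^esub> Der_bracket L n (p + m) y (Der_bracket L p m z x)
      \<oplus>\<^bsub>Der_homog L (m + n + p)\<^esub> Der_bracket L p (m + n) z (Der_bracket L m n x y)
      = \<zero>\<^bsub>Der_homog L (m + n + p)\<^esub>" (is "?l = ?r")
proof -
  obtain d0 d where x1: "x = (d0, d)" and "eg_derivation L m d0 d"
    using derivationsE[OF eg_lie_algebra_axioms m x] .
  then interpret D: eg_derivation L m d0 d by simp
  obtain e0 e where y1: "y = (e0, e)" and "eg_derivation L n e0 e"
    using derivationsE[OF eg_lie_algebra_axioms n y] .
  then interpret E: eg_derivation L n e0 e by simp
  obtain h0 h where z1: "z = (h0, h)" and "eg_derivation L p h0 h"
    using derivationsE[OF eg_lie_algebra_axioms p z] .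
  then interpret H: eg_derivation L p h0 h by simp
  have pos: "m + n + p \<ge> 1" "n + p \<ge> 1" "p + m \<ge> 1" "m + n \<ge> 1" using m n by simp_all
  note closed = Der_bracket_closed[OF m pos(2) x Der_bracket_closed[OF n p y z]]
    Der_bracket_closed[OF n pos(3) y Der_bracket_closed[OF p m z x]]
    Der_bracket_closed[OF p pos(4) z Der_bracket_closed[OF m n x y]]
  note simps = x1 y1 z1 Der_homog_def Der_bracket_def eg_simps D.d_simps E.d_simps H.d_simps ac_simps
  show ?thesis
  proof (rule derivations_eqI[of _ L "m + n + p"])
    show "?l \<in> derivations L (m + n + p)"
      using closed by (intro Der_add_closed pos) (simp_all add: ac_simps)
    show "?r \<in> derivations L (m + n + p)" by (intro Der_zero_closed pos)
  next
    fix i a assume "1 \<le> i" "a \<in> carrier (homog L i)"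
    then show "snd ?l i a = snd ?r i a" by (simp add: simps)
  next
    fix a assume "a \<in> carrier (deg0 L)"
    (* Three of the brackets occur in both orders of their arguments; antisymmetry is used for
       these only, since as a general rewrite rule it loops. *)
    then show "fst ?l a = fst ?r a"
      by (simp add: simps bracket_antisym[of "m + n" p "d n (e0 a)" "h0 a"]
        bracket_antisym[of "n + p" m "e p (h0 a)" "d0 a"]
        bracket_antisym[of "m + p" n "h m (d0 a)" "e0 a"]
        jacobi_solved[of m n p _ "d0 a" "e0 a" "h0 a"])
  qed
qed

text \<open>
  The axioms depend on the components and the bracket only; leaving the record type of \<open>M\<close> open
  makes the result apply to the full eg-Lie algebra of derivations.
\<close>

lemma Der_graded_lie_algebra:
  assumes M: "homog M = Der_homog L" "bracket M = Der_bracket L"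
  shows "graded_lie_algebra M"
proof -
  have car: "carrier (Der_homog L k) = derivations L k" for k
    by (simp add: Der_homog_def)
  show ?thesis
    by (rule graded_lie_algebra.intro; unfold M car)
      (rule Der_homog_abelian_group Der_bracket_closed Der_bracket_add_left
        Der_bracket_add_right Der_bracket_self Der_bracket_antisym Der_bracket_jacobi; assumption)+
qed

end

section \<open>Automorphisms\<close>

locale eg_automorphism = eg_lie_algebra L
  for L :: "('a, 'g, 'm) eg_lie_scheme" +
  fixes f0 :: "'g \<Rightarrow> 'g" and f :: "nat \<Rightarrow> 'a \<Rightarrow> 'a"
  assumes automorphism: "(f0, f) \<in> carrier (eg_Aut L)"
begin

abbreviation inv0 :: "'g \<Rightarrow> 'g" where
  "inv0 \<equiv> inv_into (carrier (deg0 L)) f0"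

abbreviation inv_plus :: "nat \<Rightarrow> 'a \<Rightarrow> 'a" where
  "inv_plus i \<equiv> inv_into (carrier (homog L i)) (f i)"

lemma f0_bij: "bij_betw f0 (carrier (deg0 L)) (carrier (deg0 L))"
  using automorphism by (auto simp: eg_Aut_def)

lemma f_bij: "i \<ge> 1 \<Longrightarrow> bij_betw (f i) (carrier (homog L i)) (carrier (homog L i))"
  using automorphism by (auto simp: eg_Aut_def)

lemma f0_in: "a \<in> carrier (deg0 L) \<Longrightarrow> f0 a \<in> carrier (deg0 L)"
  using f0_bij by (auto simp: bij_betw_def)

lemma f_in: "\<lbrakk>i \<ge> 1; a \<in> carrier (homog L i)\<rbrakk> \<Longrightarrow> f i a \<in> carrier (homog L i)"
  using f_bij by (auto simp: bij_betw_def)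

lemma f0_mult:
  "\<lbrakk>a \<in> carrier (deg0 L); b \<in> carrier (deg0 L)\<rbrakk>
    \<Longrightarrow> f0 (a \<otimes>\<^bsub>deg0 L\<^esub> b) = f0 a \<otimes>\<^bsub>deg0 L\<^esub> f0 b"
  using automorphism by (auto simp: eg_Aut_def eg_hom_def hom_def)

lemma f_hom: "i \<ge> 1 \<Longrightarrow> f i \<in> hom (add_monoid (homog L i)) (add_monoid (homog L i))"
  using automorphism by (auto simp: eg_Aut_def eg_hom_def additive_maps_def)

lemma f_additive:
  assumes "i \<ge> 1"
  shows "f i \<zero>\<^bsub>homog L i\<^esub> = \<zero>\<^bsub>homog L i\<^esub>"
    and "\<lbrakk>x \<in> carrier (homog L i); y \<in> carrier (homog L i)\<rbrakk>
      \<Longrightarrow> f i (x \<oplus>\<^bsub>homog L i\<^esub> y) = f i x \<oplus>\<^bsub>homog L i\<^esub> f i y"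
    and "\<lbrakk>x \<in> carrier (homog L i); y \<in> carrier (homog L i)\<rbrakk>
      \<Longrightarrow> f i (x \<ominus>\<^bsub>homog L i\<^esub> y) = f i x \<ominus>\<^bsub>homog L i\<^esub> f i y"
  using assms additive_hom_zero[OF homog_group homog_group f_hom]
    additive_hom_diff[OF homog_group homog_group f_hom] hom_mult[OF f_hom, of i x y]
  by simp_all

lemma f_bracket:
  "\<lbrakk>i \<ge> 1; j \<ge> 1; k = i + j; a \<in> carrier (homog L i); b \<in> carrier (homog L j)\<rbrakk>
    \<Longrightarrow> f k (bracket L i j a b) = bracket L i j (f i a) (f j b)"
  using automorphism by (auto simp: eg_Aut_def eg_hom_def)

lemma f_act:
  "\<lbrakk>a \<in> carrier (deg0 L); i \<ge> 1; b \<in> carrier (homog L i)\<rbrakk>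
    \<Longrightarrow> f i (act L a i b) = act L (f0 a) i (f i b)"
  using automorphism by (auto simp: eg_Aut_def eg_hom_def)

lemma inv0_simps:
  assumes "a \<in> carrier (deg0 L)"
  shows "inv0 a \<in> carrier (deg0 L)" "f0 (inv0 a) = a" "inv0 (f0 a) = a"
  using assms f0_bij by (auto simp: bij_betw_def inv_into_into f_inv_into_f)

lemma inv_plus_simps:
  assumes "i \<ge> 1" "a \<in> carrier (homog L i)"
  shows "inv_plus i a \<in> carrier (homog L i)" "f i (inv_plus i a) = a" "inv_plus i (f i a) = a"
proof -
  have "f i ` carrier (homog L i) = carrier (homog L i)" "inj_on (f i) (carrier (homog L i))"
    using f_bij[OF assms(1)] by (auto simp: bij_betw_def)
  then show "inv_plus i a \<in> carrier (homog L i)" "f i (inv_plus i a) = a" "inv_plus i (f i a) = a"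
    using assms by (auto simp: inv_into_into f_inv_into_f)
qed

text \<open>
  The inverse of a bijective homomorphism is a homomorphism: each argument is written as a value
  of \<open>f\<close>, and \<open>f\<close> is pulled out of the operation.
\<close>

lemma inv0_mult:
  assumes "a \<in> carrier (deg0 L)" "b \<in> carrier (deg0 L)"
  shows "inv0 (a \<otimes>\<^bsub>deg0 L\<^esub> b) = inv0 a \<otimes>\<^bsub>deg0 L\<^esub> inv0 b"
proof -
  have "inv0 (a \<otimes>\<^bsub>deg0 L\<^esub> b) = inv0 (f0 (inv0 a \<otimes>\<^bsub>deg0 L\<^esub> inv0 b))"
    using assms by (simp add: f0_mult inv0_simps)
  also have "\<dots> = inv0 a \<otimes>\<^bsub>deg0 L\<^esub> inv0 b"
    using assms by (intro inv0_simps deg0_closed)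
  finally show ?thesis .
qed

lemma inv_plus_add:
  assumes "i \<ge> 1" "a \<in> carrier (homog L i)" "b \<in> carrier (homog L i)"
  shows "inv_plus i (a \<oplus>\<^bsub>homog L i\<^esub> b) = inv_plus i a \<oplus>\<^bsub>homog L i\<^esub> inv_plus i b"
proof -
  have "inv_plus i (a \<oplus>\<^bsub>homog L i\<^esub> b) = inv_plus i (f i (inv_plus i a \<oplus>\<^bsub>homog L i\<^esub> inv_plus i b))"
    using assms by (simp add: f_additive inv_plus_simps)
  also have "\<dots> = inv_plus i a \<oplus>\<^bsub>homog L i\<^esub> inv_plus i b"
    using assms by (intro inv_plus_simps homog_closed)
  finally show ?thesis .
qed

lemma inv_plus_bracket:
  assumes "i \<ge> 1" "j \<ge> 1" "k = i + j" "a \<in> carrier (homog L i)" "b \<in> carrier (homog L j)"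
  shows "inv_plus k (bracket L i j a b) = bracket L i j (inv_plus i a) (inv_plus j b)"
proof -
  have "inv_plus k (bracket L i j a b)
    = inv_plus k (f k (bracket L i j (inv_plus i a) (inv_plus j b)))"
    using assms by (simp add: f_bracket inv_plus_simps)
  also have "\<dots> = bracket L i j (inv_plus i a) (inv_plus j b)"
    using assms by (simp add: inv_plus_simps bracket_in)
  finally show ?thesis .
qed

lemma inv_plus_act:
  assumes "a \<in> carrier (deg0 L)" "i \<ge> 1" "b \<in> carrier (homog L i)"
  shows "inv_plus i (act L a i b) = act L (inv0 a) i (inv_plus i b)"
proof -
  have "inv_plus i (act L a i b) = inv_plus i (f i (act L (inv0 a) i (inv_plus i b)))"
    using assms by (simp add: f_act inv_plus_simps inv0_simps)
  also have "\<dots> = act L (inv0 a) i (inv_plus i b)"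
    using assms by (intro inv_plus_simps inv0_simps act_in)
  finally show ?thesis .
qed

lemmas f_simps = f0_in f_in f0_mult f_additive f_bracket f_act
  inv0_simps inv_plus_simps inv0_mult inv_plus_add inv_plus_bracket inv_plus_act

end

lemma eg_AutE:
  assumes "eg_lie_algebra L" "u \<in> carrier (eg_Aut L)"
  obtains f0 f where "u = (f0, f)" "eg_automorphism L f0 f"
  using assms by (cases u) (auto simp: eg_automorphism_def eg_automorphism_axioms_def)

lemma eg_Aut_eqI:
  assumes "u \<in> carrier (eg_Aut L)" "v \<in> carrier (eg_Aut L)"
    and "\<And>a. a \<in> carrier (deg0 L) \<Longrightarrow> fst u a = fst v a"
    and "\<And>i a. \<lbrakk>i \<ge> 1; a \<in> carrier (homog L i)\<rbrakk> \<Longrightarrow> snd u i a = snd v i a"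
  shows "u = v"
proof (rule prod_eqI)
  show "fst u = fst v"
    using assms(1-3) by (intro extensionalityI[of _ "carrier (deg0 L)"])
      (auto simp: eg_Aut_def eg_hom_def)
  show "snd u = snd v"
  proof (rule extensionalityI[of _ "{1..}"])
    fix i :: nat assume "i \<in> {1..}"
    then show "snd u i = snd v i"
      using assms(1,2,4) by (intro extensionalityI[of _ "carrier (homog L i)"])
        (auto simp: eg_Aut_def eg_hom_def additive_maps_def PiE_def)
  qed (use assms(1,2) in \<open>auto simp: eg_Aut_def eg_hom_def PiE_def\<close>)
qed

context eg_lie_algebra
begin

lemma eg_AutI:
  assumes "f0 \<in> extensional (carrier (deg0 L))" "f \<in> extensional {1..}"
    and "\<And>i. i \<ge> 1 \<Longrightarrow> f i \<in> extensional (carrier (homog L i))"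
    and bij: "bij_betw f0 (carrier (deg0 L)) (carrier (deg0 L))"
      "\<And>i. i \<ge> 1 \<Longrightarrow> bij_betw (f i) (carrier (homog L i)) (carrier (homog L i))"
    and "\<And>a b. \<lbrakk>a \<in> carrier (deg0 L); b \<in> carrier (deg0 L)\<rbrakk>
      \<Longrightarrow> f0 (a \<otimes>\<^bsub>deg0 L\<^esub> b) = f0 a \<otimes>\<^bsub>deg0 L\<^esub> f0 b"
    and "\<And>i a b. \<lbrakk>i \<ge> 1; a \<in> carrier (homog L i); b \<in> carrier (homog L i)\<rbrakk>
      \<Longrightarrow> f i (a \<oplus>\<^bsub>homog L i\<^esub> b) = f i a \<oplus>\<^bsub>homog L i\<^esub> f i b"
    and "\<And>i j a b. \<lbrakk>i \<ge> 1; j \<ge> 1; a \<in> carrier (homog L i); b \<in> carrier (homog L j)\<rbrakk>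
      \<Longrightarrow> f (i + j) (bracket L i j a b) = bracket L i j (f i a) (f j b)"
    and "\<And>a i b. \<lbrakk>a \<in> carrier (deg0 L); i \<ge> 1; b \<in> carrier (homog L i)\<rbrakk>
      \<Longrightarrow> f i (act L a i b) = act L (f0 a) i (f i b)"
  shows "(f0, f) \<in> carrier (eg_Aut L)"
  using assms(1-3,6-) bij bij_betwE[OF bij(1)] bij_betwE[OF bij(2)]
  by (simp add: eg_Aut_def eg_hom_def additive_maps_def hom_def PiE_iff)

lemma eg_Aut_one_closed: "\<one>\<^bsub>eg_Aut L\<^esub> \<in> carrier (eg_Aut L)"
proof -
  have id: "bij_betw (\<lambda>x. x) S S" for S :: "'c set"
    using bij_betw_id[of S] by (simp add: id_def)
  have "(\<lambda>x\<in>carrier (deg0 L). x, \<lambda>m\<in>{1..}. \<lambda>x\<in>carrier (homog L m). x) \<in> carrier (eg_Aut L)"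
    by (rule eg_AutI) (simp_all add: id eg_simps)
  then show ?thesis by (simp add: eg_Aut_def)
qed

lemma eg_Aut_mult_closed:
  assumes "u \<in> carrier (eg_Aut L)" "v \<in> carrier (eg_Aut L)"
  shows "u \<otimes>\<^bsub>eg_Aut L\<^esub> v \<in> carrier (eg_Aut L)"
proof -
  obtain f0 f where u: "u = (f0, f)" and "eg_automorphism L f0 f"
    using eg_AutE[OF eg_lie_algebra_axioms assms(1)] .
  then interpret F: eg_automorphism L f0 f by simp
  obtain h0 h where v: "v = (h0, h)" and "eg_automorphism L h0 h"
    using eg_AutE[OF eg_lie_algebra_axioms assms(2)] .
  then interpret H: eg_automorphism L h0 h by simp
  have "(compose (carrier (deg0 L)) f0 h0, \<lambda>m\<in>{1..}. compose (carrier (homog L m)) (f m) (h m))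
    \<in> carrier (eg_Aut L)"
    by (rule eg_AutI)
      (simp_all add: bij_betw_compose[OF H.f0_bij F.f0_bij] bij_betw_compose[OF H.f_bij F.f_bij]
        compose_eq eg_simps F.f_simps H.f_simps)
  then show ?thesis by (simp add: u v eg_Aut_def)
qed

lemma eg_Aut_inv_closed:
  assumes "eg_automorphism L f0 f"
  shows "(\<lambda>a\<in>carrier (deg0 L). inv_into (carrier (deg0 L)) f0 a,
    \<lambda>i\<in>{1..}. \<lambda>a\<in>carrier (homog L i). inv_into (carrier (homog L i)) (f i) a)
    \<in> carrier (eg_Aut L)"
proof -
  interpret F: eg_automorphism L f0 f by fact
  show ?thesis
    by (rule eg_AutI)
      (simp_all add: bij_betw_inv_into[OF F.f0_bij] bij_betw_inv_into[OF F.f_bij]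
        bij_betw_restrict_eq eg_simps F.f_simps)
qed

lemma eg_Aut_group: "group (eg_Aut L)"
proof (rule groupI)
  fix u v w assume uvw: "u \<in> carrier (eg_Aut L)" "v \<in> carrier (eg_Aut L)" "w \<in> carrier (eg_Aut L)"
  obtain f0 f where u: "u = (f0, f)" and "eg_automorphism L f0 f"
    using eg_AutE[OF eg_lie_algebra_axioms uvw(1)] .
  then interpret F: eg_automorphism L f0 f by simp
  obtain h0 h where v: "v = (h0, h)" and "eg_automorphism L h0 h"
    using eg_AutE[OF eg_lie_algebra_axioms uvw(2)] .
  then interpret H: eg_automorphism L h0 h by simp
  obtain k0 k where w: "w = (k0, k)" and "eg_automorphism L k0 k"
    using eg_AutE[OF eg_lie_algebra_axioms uvw(3)] .
  then interpret K: eg_automorphism L k0 k by simp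
  note simps = u v w eg_Aut_def compose_eq F.f_simps H.f_simps K.f_simps
  show "u \<otimes>\<^bsub>eg_Aut L\<^esub> v \<otimes>\<^bsub>eg_Aut L\<^esub> w = u \<otimes>\<^bsub>eg_Aut L\<^esub> (v \<otimes>\<^bsub>eg_Aut L\<^esub> w)"
    by (rule eg_Aut_eqI[of _ L]; (intro eg_Aut_mult_closed uvw)?) (simp_all add: simps)
  show "\<one>\<^bsub>eg_Aut L\<^esub> \<otimes>\<^bsub>eg_Aut L\<^esub> u = u"
    by (rule eg_Aut_eqI[of _ L]; (intro eg_Aut_mult_closed eg_Aut_one_closed uvw)?)
      (simp_all add: simps)
  show "\<exists>v\<in>carrier (eg_Aut L). v \<otimes>\<^bsub>eg_Aut L\<^esub> u = \<one>\<^bsub>eg_Aut L\<^esub>"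
    by (rule bexI[OF _ eg_Aut_inv_closed[OF F.eg_automorphism_axioms]], rule eg_Aut_eqI[of _ L];
        (intro eg_Aut_mult_closed eg_Aut_one_closed eg_Aut_inv_closed F.eg_automorphism_axioms uvw)?)
      (simp_all add: simps)
qed (intro eg_Aut_mult_closed eg_Aut_one_closed; assumption)+

section \<open>The action on derivations\<close>

text \<open>
  Each condition for \<open>f d f\<^sup>-\<^sup>1\<close> at \<open>(a, b)\<close> is the image under \<open>f\<close> of the condition for \<open>d\<close>
  at \<open>(f\<^sup>-\<^sup>1 a, f\<^sup>-\<^sup>1 b)\<close>.
\<close>

lemma Der_act_closed:
  assumes u: "u \<in> carrier (eg_Aut L)" and m: "m \<ge> 1" and x: "x \<in> derivations L m"
  shows "Der_act L u m x \<in> derivations L m"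
proof -
  obtain f0 f where u1: "u = (f0, f)" and "eg_automorphism L f0 f"
    using eg_AutE[OF eg_lie_algebra_axioms u] .
  then interpret F: eg_automorphism L f0 f by simp
  obtain d0 d where x1: "x = (d0, d)" and "eg_derivation L m d0 d"
    using derivationsE[OF eg_lie_algebra_axioms m x] .
  then interpret D: eg_derivation L m d0 d by simp
  show ?thesis
    unfolding u1 x1 Der_act_def prod.case
    by (rule derivationsI) (simp_all add: eg_simps F.f_simps D.d_simps ac_simps)
qed

lemma Der_act_add:
  assumes u: "u \<in> carrier (eg_Aut L)" and m: "m \<ge> 1"
    and xy: "x \<in> derivations L m" "y \<in> derivations L m"
  shows "Der_act L u m (x \<oplus>\<^bsub>Der_homog L m\<^esub> y)
    = Der_act L u m x \<oplus>\<^bsub>Der_homog L m\<^esub> Der_act L u m y"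
proof -
  obtain f0 f where u1: "u = (f0, f)" and "eg_automorphism L f0 f"
    using eg_AutE[OF eg_lie_algebra_axioms u] .
  then interpret F: eg_automorphism L f0 f by simp
  obtain d0 d where x1: "x = (d0, d)" and "eg_derivation L m d0 d"
    using derivationsE[OF eg_lie_algebra_axioms m xy(1)] .
  then interpret D: eg_derivation L m d0 d by simp
  obtain e0 e where y1: "y = (e0, e)" and "eg_derivation L m e0 e"
    using derivationsE[OF eg_lie_algebra_axioms m xy(2)] .
  then interpret E: eg_derivation L m e0 e by simp
  show ?thesis
    by (rule derivations_eqI[of _ L m]; (intro Der_act_closed Der_add_closed u m xy)?)
      (simp_all add: u1 x1 y1 Der_act_def Der_homog_def
        eg_simps F.f_simps D.d_simps E.d_simps ac_simps)
qed

lemma Der_act_bracket: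
  assumes u: "u \<in> carrier (eg_Aut L)" and m: "m \<ge> 1" and n: "n \<ge> 1"
    and x: "x \<in> derivations L m" and y: "y \<in> derivations L n"
  shows "Der_act L u (m + n) (Der_bracket L m n x y)
    = Der_bracket L m n (Der_act L u m x) (Der_act L u n y)"
proof -
  obtain f0 f where u1: "u = (f0, f)" and "eg_automorphism L f0 f"
    using eg_AutE[OF eg_lie_algebra_axioms u] .
  then interpret F: eg_automorphism L f0 f by simp
  obtain d0 d where x1: "x = (d0, d)" and "eg_derivation L m d0 d"
    using derivationsE[OF eg_lie_algebra_axioms m x] .
  then interpret D: eg_derivation L m d0 d by simp
  obtain e0 e where y1: "y = (e0, e)" and "eg_derivation L n e0 e"
    using derivationsE[OF eg_lie_algebra_axioms n y] .
  then interpret E: eg_derivation L n e0 e by simp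
  have mn: "m + n \<ge> 1" using m by simp
  show ?thesis
    by (rule derivations_eqI[of _ L "m + n"]; (intro Der_act_closed Der_bracket_closed u m n mn x y)?)
      (simp_all add: u1 x1 y1 Der_act_def Der_bracket_def
        eg_simps F.f_simps D.d_simps E.d_simps ac_simps)
qed

lemma Der_act_one:
  assumes m: "m \<ge> 1" and x: "x \<in> derivations L m"
  shows "Der_act L \<one>\<^bsub>eg_Aut L\<^esub> m x = x"
proof -
  obtain d0 d where x1: "x = (d0, d)" and "eg_derivation L m d0 d"
    using derivationsE[OF eg_lie_algebra_axioms m x] .
  then interpret D: eg_derivation L m d0 d by simp
  have inv_id: "inv_into S (\<lambda>x\<in>S. x) a = a" if "a \<in> S" for S :: "'c set" and a
    using that by (intro inv_into_f_eq) (auto simp: inj_on_def)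
  show ?thesis
    by (rule derivations_eqI[of _ L m]; (intro Der_act_closed eg_Aut_one_closed m x)?)
      (simp_all add: x1 Der_act_def eg_Aut_def inv_id D.d_simps)
qed

lemma Der_act_mult:
  assumes uv: "u \<in> carrier (eg_Aut L)" "v \<in> carrier (eg_Aut L)"
    and m: "m \<ge> 1" and x: "x \<in> derivations L m"
  shows "Der_act L (u \<otimes>\<^bsub>eg_Aut L\<^esub> v) m x = Der_act L u m (Der_act L v m x)"
proof -
  obtain f0 f where u: "u = (f0, f)" and "eg_automorphism L f0 f"
    using eg_AutE[OF eg_lie_algebra_axioms uv(1)] .
  then interpret F: eg_automorphism L f0 f by simp
  obtain h0 h where v: "v = (h0, h)" and "eg_automorphism L h0 h"
    using eg_AutE[OF eg_lie_algebra_axioms uv(2)] .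
  then interpret H: eg_automorphism L h0 h by simp
  obtain d0 d where x1: "x = (d0, d)" and "eg_derivation L m d0 d"
    using derivationsE[OF eg_lie_algebra_axioms m x] .
  then interpret D: eg_derivation L m d0 d by simp
  have inv0: "inv_into (carrier (deg0 L)) (compose (carrier (deg0 L)) f0 h0) a = H.inv0 (F.inv0 a)"
    if "a \<in> carrier (deg0 L)" for a
    using that bij_betw_compose[OF H.f0_bij F.f0_bij]
    by (intro inv_into_f_eq) (auto simp: bij_betw_def compose_eq F.f_simps H.f_simps)
  have inv_plus: "inv_into (carrier (homog L i)) (compose (carrier (homog L i)) (f i) (h i)) a
      = H.inv_plus i (F.inv_plus i a)"
    if "i \<ge> 1" "a \<in> carrier (homog L i)" for i a
    using that bij_betw_compose[OF H.f_bij F.f_bij, of i]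
    by (intro inv_into_f_eq) (auto simp: bij_betw_def compose_eq F.f_simps H.f_simps)
  show ?thesis
    by (rule derivations_eqI[of _ L m]; (intro Der_act_closed eg_Aut_mult_closed uv m x)?)
      (simp_all add: u v x1 Der_act_def eg_Aut_def inv0 inv_plus compose_eq
        eg_simps F.f_simps H.f_simps D.d_simps)
qed

end

theorem theorem5p3:
  fixes L :: "('a, 'g) eg_lie"
  assumes "eg_lie_algebra L"
  shows "eg_lie_algebra (Der_eg L)"
proof -
  interpret eg_lie_algebra L by fact
  have fields: "homog (Der_eg L) = Der_homog L" "bracket (Der_eg L) = Der_bracket L"
    "deg0 (Der_eg L) = eg_Aut L" "act (Der_eg L) = Der_act L"
    by (simp_all add: Der_eg_def Der_plus_def)
  have car: "carrier (Der_homog L k) = derivations L k" for k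
    by (simp add: Der_homog_def)
  have act_hom: "Der_act L u m \<in> hom (add_monoid (Der_homog L m)) (add_monoid (Der_homog L m))"
    if "u \<in> carrier (eg_Aut L)" "m \<ge> 1" for u m
    using that by (intro homI) (simp_all add: car Der_act_closed Der_act_add)
  have "eg_lie_algebra_axioms (Der_eg L)"
    by (rule eg_lie_algebra_axioms.intro; unfold fields)
      (rule act_hom eg_Aut_group Der_act_bracket Der_act_one Der_act_mult; simp only: car)+
  then show ?thesis
    by (intro eg_lie_algebra.intro Der_graded_lie_algebra fields)
qed

end
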